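(* Let $a<0$, let $k>0$ be the coupling parameter, and let $x_1^0,x_2^0\in\mathbb{R}$. Consider the original coupled dynamics of two identical oscillators with unit noise strengths, $$\dot x_1=a x_1+k(x_2-x_1)+\dot W_1,\qquad \dot x_2=-k(x_2-x_1)+a x_2+\dot W_2,$$ starting at the deterministic initial datum $(x_1,x_2)(0)=(x_1^0,x_2^0)$, and the reduced dynamics $$d\hat x(t)=\lambda_+\hat x(t)\,dt+\hat D\,dW_t,\qquad \hat x(0)=x_1^0,$$ where $$\lambda_+=a,\qquad \overline\Sigma_{11}=-\frac12\Big(\frac1{a-2k}+\frac1a\Big),\qquad \hat D=-\lambda_+\overline\Sigma_{11}.$$ Let $\rho_1(t)$ be the distribution of $x_1(t)$ and let $\hat\rho_1(t)$ be the distribution of $\hat x(t)$. Then there exists a constant $C>0$ such that the following statements hold: (i) $W_2(\rho_1(t),\hat\rho_1(t))^2\le Ck$; (ii) $\max\{W_2(\rho_1(t),\rho_\infty),\,W_2(\hat\rho_1(t),\rho_\infty)\}\le Ce^{at}$, where $\rho_\infty=\mathcal N(0,\overline\Sigma_{11})$; (iii) $W_2(\rho_1(t),\hat\rho_1(t))\le Ce^{at}$.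
   Context: $\dot W_1,\dot W_2$ are formal derivatives of Wiener processes (white noises) and $W_t$ is a Wiener process. Noise convention: the matrix multiplying the noise in the coupled system, here the identity $I$, is called the diffusion matrix $\boldsymbol D$, and the Fokker–Planck equation associated with the coupled system, solved by the joint density $\rho(t,x_1,x_2)$, is taken to be $\partial_t\rho=-\mathrm{div}(\mathbf Q x\rho)+\mathrm{div}(\boldsymbol D\nabla\rho)$ on $\mathbb{R}^2$, with $x=(x_1,x_2)$ and $$\mathbf Q=\begin{pmatrix}a-k&k\\ k&a-k\end{pmatrix},\qquad \boldsymbol D=I.$$ Likewise $\hat D$ is called the diffusion coefficient of the reduced dynamics, whose law is taken to be $\hat\rho_1(t)=\mathcal N\big(e^{\lambda_+t}x_1^0,\,-\tfrac{\hat D}{\lambda_+}(1-e^{2\lambda_+t})\big)$. With this convention, $\overline\Sigma_{11}$ is the limit as $t\to\infty$ of the variance of $x_1(t)$. The statement does not specify how $C$ depends on $a$, $k$ and the initial data. $\mathcal N(m,s)$ denotes the Gaussian measure on $\mathbb{R}$ with mean $m$ and variance $s$. For probability measures $\mu,\nu$ on $\mathbb{R}$ with finite second moment, $W_2(\mu,\nu)$ is the $L^2$-Wasserstein distance, $$W_2^2(\mu,\nu)=\inf_{\pi\in\Gamma(\mu,\nu)}\int_{\mathbb{R}\times\mathbb{R}}|x-y|^2\,\pi(dx,dy),$$ where $\Gamma(\mu,\nu)$ is the set of all probability measures on $\mathbb{R}\times\mathbb{R}$ with first marginal $\mu$ and second marginal $\nu$. *)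

theory Defs
  imports "HOL-Probability.Probability"
begin

definition wiener_process :: "'a measure \<Rightarrow> (real \<Rightarrow> 'a \<Rightarrow> real) \<Rightarrow> bool" where
  "wiener_process M W \<longleftrightarrow>
     prob_space M \<and>
     (\<forall>t\<ge>0. W t \<in> borel_measurable M) \<and>
     (AE \<omega> in M. W 0 \<omega> = 0) \<and>
     (AE \<omega> in M. continuous_on {0..} (\<lambda>t. W t \<omega>)) \<and>
     (\<forall>s t. 0 \<le> s \<longrightarrow> s < t \<longrightarrow>
        distributed M lborel (\<lambda>\<omega>. W t \<omega> - W s \<omega>) (normal_density 0 (sqrt (t - s)))) \<and>
     (\<forall>(n::nat) (\<tau> :: nat \<Rightarrow> real). 0 \<le> \<tau> 0 \<longrightarrow> (\<forall>i<n. \<tau> i < \<tau> (Suc i)) \<longrightarrow>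
        prob_space.indep_vars M (\<lambda>_. borel) (\<lambda>i \<omega>. W (\<tau> (Suc i)) \<omega> - W (\<tau> i) \<omega>) {..<n})"

text \<open>Independence of two processes means independence of their paths, viewed as random
  elements of the product space of all real functions on the half-line \<open>t \<ge> 0\<close>.\<close>

definition indep_processes ::
    "'a measure \<Rightarrow> (real \<Rightarrow> 'a \<Rightarrow> real) \<Rightarrow> (real \<Rightarrow> 'a \<Rightarrow> real) \<Rightarrow> bool" where
  "indep_processes M X Y \<longleftrightarrow>
     prob_space.indep_var M
       (PiM {0..} (\<lambda>_. borel)) (\<lambda>\<omega>. \<lambda>t\<in>{0..}. X t \<omega>)
       (PiM {0..} (\<lambda>_. borel)) (\<lambda>\<omega>. \<lambda>t\<in>{0..}. Y t \<omega>)"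

text \<open>A diffusion coefficient \<open>D\<close> in front of the noise means that the Fokker-Planck
  equation of the dynamics with drift \<open>b\<close> is
  \<open>\<partial>\<^sub>t \<rho> = - div (b \<rho>) + div (D \<nabla>\<rho>)\<close>, without a factor \<open>1/2\<close>. In terms of a
  standard Wiener process the noise is therefore \<open>sqrt (2 * D) dW\<close>.\<close>

definition noise_amplitude :: "real \<Rightarrow> real" where
  "noise_amplitude D = sqrt (2 * D)"

text \<open>The noise is additive, so the stochastic differential equations are understood
  pathwise, in integrated form:
  \<open>x t - x 0 - noise_amplitude D * W t = integral {0..t} (\<lambda>s. drift (x s))\<close>.
  In the coupled system the diffusion matrix is the identity, that is, \<open>D = 1\<close> in both
  components and the two Wiener processes are independent.\<close>

definition coupled_dynamics ::
    "real \<Rightarrow> real \<Rightarrow> real \<Rightarrow> real \<Rightarrow> 'a measure \<Rightarrow> (real \<Rightarrow> 'a \<Rightarrow> real) \<Rightarrow> (real \<Rightarrow> 'a \<Rightarrow> real)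
      \<Rightarrow> (real \<Rightarrow> 'a \<Rightarrow> real) \<Rightarrow> (real \<Rightarrow> 'a \<Rightarrow> real) \<Rightarrow> bool" where
  "coupled_dynamics a k x10 x20 M W1 W2 X1 X2 \<longleftrightarrow>
     wiener_process M W1 \<and> wiener_process M W2 \<and> indep_processes M W1 W2 \<and>
     (\<forall>t\<ge>0. X1 t \<in> borel_measurable M) \<and> (\<forall>t\<ge>0. X2 t \<in> borel_measurable M) \<and>
     (AE \<omega> in M. \<forall>t\<ge>0.
        ((\<lambda>s. a * X1 s \<omega> + k * (X2 s \<omega> - X1 s \<omega>)) has_integral
           (X1 t \<omega> - x10 - noise_amplitude 1 * W1 t \<omega>)) {0..t} \<and>
        ((\<lambda>s. - k * (X2 s \<omega> - X1 s \<omega>) + a * X2 s \<omega>) has_integral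
           (X2 t \<omega> - x20 - noise_amplitude 1 * W2 t \<omega>)) {0..t})"

definition lambda_plus :: "real \<Rightarrow> real" where
  "lambda_plus a = a"

definition Sigma11_bar :: "real \<Rightarrow> real \<Rightarrow> real" where
  "Sigma11_bar a k = - (1/2) * (1 / (a - 2 * k) + 1 / a)"

definition D_hat :: "real \<Rightarrow> real \<Rightarrow> real" where
  "D_hat a k = - lambda_plus a * Sigma11_bar a k"

definition reduced_dynamics ::
    "real \<Rightarrow> real \<Rightarrow> real \<Rightarrow> 'a measure \<Rightarrow> (real \<Rightarrow> 'a \<Rightarrow> real) \<Rightarrow> (real \<Rightarrow> 'a \<Rightarrow> real) \<Rightarrow> bool" where
  "reduced_dynamics a k x10 M W X \<longleftrightarrow>
     wiener_process M W \<and>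
     (\<forall>t\<ge>0. X t \<in> borel_measurable M) \<and>
     (AE \<omega> in M. \<forall>t\<ge>0.
        ((\<lambda>s. lambda_plus a * X s \<omega>) has_integral
           (X t \<omega> - x10 - noise_amplitude (D_hat a k) * W t \<omega>)) {0..t})"

text \<open>The second argument is the variance, not the standard deviation; it must be positive.\<close>

definition gaussian :: "real \<Rightarrow> real \<Rightarrow> real measure" where
  "gaussian m v = density lborel (normal_density m (sqrt v))"

definition couplings :: "real measure \<Rightarrow> real measure \<Rightarrow> (real \<times> real) measure set" where
  "couplings \<mu> \<nu> = {\<pi>. prob_space \<pi> \<and> sets \<pi> = sets borel \<and>
                       distr \<pi> borel fst = \<mu> \<and> distr \<pi> borel snd = \<nu>}"

text \<open>The distance takes values in \<^typ>\<open>ennreal\<close>, so that an upper bound by a real number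
  includes the finiteness of the transport cost.\<close>

definition transport_cost :: "real measure \<Rightarrow> real measure \<Rightarrow> ennreal" where
  "transport_cost \<mu> \<nu> =
     (INF \<pi> \<in> couplings \<mu> \<nu>. \<integral>\<^sup>+ z. ennreal (\<bar>fst z - snd z\<bar>\<^sup>2) \<partial>\<pi>)"

definition W2_dist :: "real measure \<Rightarrow> real measure \<Rightarrow> ennreal" where
  "W2_dist \<mu> \<nu> = (if transport_cost \<mu> \<nu> = \<infinity> then \<infinity>
                  else ennreal (sqrt (enn2real (transport_cost \<mu> \<nu>))))"

end

theory Submission imports Defs begin

text \<open>Pathwise, a solution of a linear equation with additive noise is a limit of Riemann sums
  \<open>\<Sum> exp (a * (t - t\<^sub>i)) * (w t\<^sub>i\<^sub>+\<^sub>1 - w t\<^sub>i)\<close>; for a Wiener path these sums are Gaussian, so their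
  characteristic functions identify the law of the solution and no stochastic integral is needed.
  In the coupled system \<open>x\<^sub>1 + x\<^sub>2\<close> and \<open>x\<^sub>1 - x\<^sub>2\<close> solve such equations with the rates \<open>a\<close> and
  \<open>a - 2 * k\<close>. Every law in the statement is thus an image \<open>m + s * Z\<close> of one standard
  normal \<open>Z\<close>, and using the same \<open>Z\<close> for two of them bounds the squared distance by
  \<open>(m - m')\<^sup>2 + (s - s')\<^sup>2\<close>. The term in \<open>s\<close> is at most the difference of the variances, since
  \<open>(sqrt u - sqrt v)\<^sup>2 \<le> \<bar>u - v\<bar>\<close>, an
  estimate that does not degenerate as the variances vanish at \<open>t = 0\<close>.\<close>

section \<open>Linear equations with additive noise along a single path\<close>

text \<open>The integrator \<open>w\<close> is left general: a Wiener path gives an approximate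
  Wiener integral, while \<open>w = (\<lambda>s. s)\<close> gives the ordinary Riemann sum that
  appears as its variance.\<close>

definition riemann_sum :: "(real \<Rightarrow> real) \<Rightarrow> (real \<Rightarrow> real) \<Rightarrow> real \<Rightarrow> nat \<Rightarrow> real" where
  "riemann_sum f w t n =
     (\<Sum>i<n. f (t * real i / real n) * (w (t * real (Suc i) / real n) - w (t * real i / real n)))"

text \<open>This is the local error of one step of the Riemann sum. The path \<open>w\<close> need
  not be differentiable, but \<open>h = x - w\<close> is, so the mean value inequality applies once
  the noise is frozen at \<open>w q\<close>. The error is proportional to
  \<open>e * (q - p)\<close>, hence summable over a partition.\<close>

lemma linear_ode_increment:
  fixes a t p q :: real and x w :: "real \<Rightarrow> real"
  assumes sol: "\<And>s. s \<in> {0..t} \<Longrightarrow> ((\<lambda>r. a * x r) has_integral (x s - x0 - w s)) {0..s}"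
    and w: "continuous_on {0..t} w"
    and pq: "0 \<le> p" "p \<le> q" "q \<le> t"
    and osc: "\<And>s. s \<in> {p..q} \<Longrightarrow> \<bar>w q - w s\<bar> \<le> e"
  shows "\<bar>exp (a * (t - p)) * (w q - w p) - (exp (a * (t - q)) * x q - exp (a * (t - p)) * x p)\<bar>
           \<le> \<bar>a\<bar> * exp (\<bar>a\<bar> * t) * e * (q - p)"
proof -
  have int: "(\<lambda>r. a * x r) integrable_on {0..t}"
    using sol[of t] pq by auto
  have x_eq: "x s = x0 + w s + integral {0..s} (\<lambda>r. a * x r)" if "s \<in> {0..t}" for s
    using integral_unique[OF sol[OF that]] by simp
  \<comment> \<open>The integral equation itself makes \<open>x\<close> continuous; this is what
    permits differentiating the indefinite integral in \<open>h\<close>.\<close>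
  have "continuous_on {0..t} (\<lambda>s. x0 + w s + integral {0..s} (\<lambda>r. a * x r))"
    using w indefinite_integral_continuous_1[OF int] by (intro continuous_intros)
  then have x: "continuous_on {0..t} x"
    by (rule continuous_on_eq) (simp only: x_eq)
  define h where "h s = x0 + integral {0..s} (\<lambda>r. a * x r)" for s
  have h: "(h has_real_derivative a * x s) (at s within {0..t})" if "s \<in> {0..t}" for s
    unfolding h_def
    by (rule derivative_eq_intros integral_has_real_derivative that x continuous_intros refl | simp)+
  txt \<open>The quantity to be bounded is the increment of this \<open>g\<close>, whose derivative contains only
    the oscillation \<open>w q - w s\<close>.\<close>
  define g where "g s = - exp (a * (t - s)) * w q - exp (a * (t - s)) * h s" for s
  have hx: "h s = x s - w s" if "s \<in> {0..t}" for s
    using x_eq[OF that] by (simp add: h_def)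
  have "norm (g q - g p) \<le> (\<bar>a\<bar> * exp (\<bar>a\<bar> * t) * e) * norm (q - p)"
  proof (rule field_differentiable_bound[where S = "{p..q}"
        and f' = "\<lambda>s. a * exp (a * (t - s)) * (w q - w s)"])
    fix s assume s: "s \<in> {p..q}"
    with pq have s': "s \<in> {0..t}" by auto
    have "(h has_real_derivative a * x s) (at s within {p..q})"
      using h[OF s'] by (rule DERIV_subset) (use pq in auto)
    then show "(g has_field_derivative a * exp (a * (t - s)) * (w q - w s)) (at s within {p..q})"
      unfolding g_def
      by (auto intro!: derivative_eq_intros simp: hx[OF s'] algebra_simps)
    have "a * (t - s) \<le> \<bar>a\<bar> * (t - s)" using s' by (intro mult_right_mono) auto
    also have "\<dots> \<le> \<bar>a\<bar> * t" using s' by (intro mult_left_mono) auto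
    finally show "norm (a * exp (a * (t - s)) * (w q - w s)) \<le> \<bar>a\<bar> * exp (\<bar>a\<bar> * t) * e"
      unfolding real_norm_def abs_mult using osc[OF s] by (intro mult_mono) auto
  qed (use pq in auto)
  moreover have "g q - g p = exp (a * (t - p)) * (w q - w p)
      - (exp (a * (t - q)) * x q - exp (a * (t - p)) * x p)"
    using hx[of p] hx[of q] pq by (simp add: g_def right_diff_distrib)
  ultimately show ?thesis using pq by simp
qed

text \<open>The increments of \<open>exp (a * (t - s)) * x s\<close> telescope to the limit, and
  each differs from a summand by the local error. Uniform continuity of \<open>w\<close> makes the
  oscillation \<open>e\<close> small on all cells at once, so the total error is at most
  \<open>B * e\<close>.\<close>

lemma linear_ode_riemann_sum:
  fixes a t :: real and x w :: "real \<Rightarrow> real"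
  assumes "0 \<le> t"
    and sol: "\<And>s. s \<in> {0..t} \<Longrightarrow> ((\<lambda>r. a * x r) has_integral (x s - x0 - w s)) {0..s}"
    and w: "continuous_on {0..t} w" and w0: "w 0 = 0"
  shows "riemann_sum (\<lambda>s. exp (a * (t - s))) w t \<longlonglongrightarrow> x t - exp (a * t) * x0"
proof (rule LIMSEQ_I)
  fix r :: real assume "0 < r"
  define B where "B = \<bar>a\<bar> * exp (\<bar>a\<bar> * t) * t"
  have "0 \<le> B" using \<open>0 \<le> t\<close> by (simp add: B_def)
  \<comment> \<open>The denominator is \<open>B + 1\<close> because \<open>B\<close> vanishes for
    \<open>a = 0\<close> or \<open>t = 0\<close>; it also makes \<open>B * e < r\<close>
    strict.\<close>
  define e where "e = r / (B + 1)"
  have "0 < e" using \<open>0 < r\<close> \<open>0 \<le> B\<close> by (simp add: e_def)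
  have "uniformly_continuous_on {0..t} w"
    by (rule compact_uniformly_continuous[OF w]) simp
  then obtain d where d: "d > 0"
    "\<And>u v. u \<in> {0..t} \<Longrightarrow> v \<in> {0..t} \<Longrightarrow> \<bar>u - v\<bar> < d \<Longrightarrow> \<bar>w u - w v\<bar> < e"
    unfolding uniformly_continuous_on_def dist_real_def using \<open>0 < e\<close> by metis
  obtain N :: nat where N: "t / d < real N" using reals_Archimedean2 by blast
  have x0: "x 0 = x0"
    using sol[of 0] \<open>0 \<le> t\<close> w0 has_integral_unique[OF _ has_integral_refl(2)] by fastforce
  show "\<exists>N. \<forall>n\<ge>N. norm (riemann_sum (\<lambda>s. exp (a * (t - s))) w t n - (x t - exp (a * t) * x0)) < r"
  \<comment> \<open>\<open>Suc N\<close> instead of \<open>N\<close> ensures that \<open>n\<close>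
    is positive, so the grid points are genuine quotients.\<close>
  proof (intro exI[of _ "Suc N"] allI impI)
    fix n assume n: "n \<ge> Suc N"
    define \<tau> where "\<tau> i = t * real i / real n" for i
    have n0: "real n > 0" using n by simp
    have step: "\<tau> (Suc i) - \<tau> i = t / real n" for i
      by (simp add: \<tau>_def distrib_left add_divide_distrib)
    have "t / d < real n" using N n by linarith
    then have small: "t / real n < d" using n0 d(1) by (simp add: field_simps)
    have tau: "0 \<le> \<tau> i" "\<tau> i \<le> \<tau> (Suc i)" for i
      using \<open>0 \<le> t\<close> n0 by (auto simp: \<tau>_def intro!: divide_right_mono mult_left_mono)
    have tau_le: "\<tau> i \<le> t" if "i \<le> n" for i
      using that n0 \<open>0 \<le> t\<close> by (simp add: \<tau>_def divide_le_eq mult_left_mono)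
    define E where "E s = exp (a * (t - s))" for s
    have inc: "\<bar>E (\<tau> i) * (w (\<tau> (Suc i)) - w (\<tau> i))
        - (E (\<tau> (Suc i)) * x (\<tau> (Suc i)) - E (\<tau> i) * x (\<tau> i))\<bar>
        \<le> \<bar>a\<bar> * exp (\<bar>a\<bar> * t) * e * (t / real n)" if "i < n" for i
      unfolding E_def step[of i, symmetric]
    proof (rule linear_ode_increment[OF sol w])
      fix s assume s: "s \<in> {\<tau> i..\<tau> (Suc i)}"
      show "\<bar>w (\<tau> (Suc i)) - w s\<bar> \<le> e"
        using s step[of i] small tau[of i] tau_le[of "Suc i"] that
        by (intro less_imp_le d(2)) auto
    qed (use tau tau_le[of "Suc i"] that in auto)
    have "x t - exp (a * t) * x0 = (\<Sum>i<n. E (\<tau> (Suc i)) * x (\<tau> (Suc i)) - E (\<tau> i) * x (\<tau> i))"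
      using n0 by (subst sum_lessThan_telescope) (simp add: E_def \<tau>_def x0)
    then have "\<bar>riemann_sum E w t n - (x t - exp (a * t) * x0)\<bar>
        = \<bar>\<Sum>i<n. E (\<tau> i) * (w (\<tau> (Suc i)) - w (\<tau> i))
            - (E (\<tau> (Suc i)) * x (\<tau> (Suc i)) - E (\<tau> i) * x (\<tau> i))\<bar>"
      by (simp add: riemann_sum_def \<tau>_def sum_subtractf)
    also have "\<dots> \<le> (\<Sum>i<n. \<bar>a\<bar> * exp (\<bar>a\<bar> * t) * e * (t / real n))"
      using inc by (intro order_trans[OF sum_abs] sum_mono) auto
    also have "\<dots> = B * e" using n0 by (simp add: B_def)
    also have "\<dots> < r"
      using \<open>0 < r\<close> \<open>0 \<le> B\<close> by (simp add: e_def field_simps)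
    finally show "norm (riemann_sum (\<lambda>s. exp (a * (t - s))) w t n - (x t - exp (a * t) * x0)) < r"
      by (simp add: E_def[abs_def])
  qed
qed

text \<open>The function \<open>(exp (a * s) - 1) / a\<close> solves the linear equation with
  \<open>w s = s\<close> and initial value \<open>0\<close>, so the preceding convergence result
  already contains this limit.\<close>

lemma riemann_sum_exp:
  fixes a t :: real
  assumes "0 \<le> t" "a \<noteq> 0"
  shows "riemann_sum (\<lambda>s. exp (a * (t - s))) (\<lambda>s. s) t \<longlonglongrightarrow> (exp (a * t) - 1) / a"
proof -
  have "riemann_sum (\<lambda>s. exp (a * (t - s))) (\<lambda>s. s) t
      \<longlonglongrightarrow> (exp (a * t) - 1) / a - exp (a * t) * 0"
  proof (rule linear_ode_riemann_sum)
    fix s assume s: "s \<in> {0..t}"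
    have "((\<lambda>r. exp (a * r) - 1) has_integral (exp (a * s) / a - s) - (exp (a * 0) / a - 0)) {0..s}"
      using s \<open>a \<noteq> 0\<close>
      by (intro fundamental_theorem_of_calculus)
         (auto simp flip: has_real_derivative_iff_has_vector_derivative intro!: derivative_eq_intros)
    then show "((\<lambda>r. a * ((exp (a * r) - 1) / a)) has_integral (exp (a * s) - 1) / a - 0 - s) {0..s}"
      using \<open>a \<noteq> 0\<close> by (simp add: diff_divide_distrib algebra_simps)
  qed (use assms in \<open>auto intro: continuous_intros\<close>)
  then show ?thesis by simp
qed

section \<open>Characteristic functions and Gaussian limit laws\<close>

lemma char_distr:
  assumes "X \<in> borel_measurable M"
  shows "char (distr M borel X) r = (CLINT \<omega>|M. iexp (r * X \<omega>))"
  unfolding char_def using assms by (subst integral_distr) auto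

text \<open>The increment is normalised to a standard normal, and the factor
  \<open>c * \<sigma>\<close> moves into the frequency. The case \<open>s = t\<close> is separate,
  since \<open>wiener_process\<close> prescribes a density only for \<open>s < t\<close>.\<close>

lemma wiener_increment_char:
  assumes W: "wiener_process M W" and st: "0 \<le> s" "s \<le> t"
  shows "char (distr M borel (\<lambda>\<omega>. c * (W t \<omega> - W s \<omega>))) r
           = of_real (exp (- (r\<^sup>2 * (c\<^sup>2 * (t - s))) / 2))"
proof (cases "s = t")
  case True
  interpret prob_space M using W by (simp add: wiener_process_def)
  show ?thesis using True by (simp add: char_def integral_return)
next
  case False
  interpret prob_space M using W by (simp add: wiener_process_def)
  have [measurable]: "W t \<in> borel_measurable M" "W s \<in> borel_measurable M"
    using W st by (auto simp: wiener_process_def)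
  define \<sigma> where "\<sigma> = sqrt (t - s)"
  have \<sigma>: "\<sigma> > 0" "\<sigma>\<^sup>2 = t - s" using False st by (auto simp: \<sigma>_def)
  have "distributed M lborel (\<lambda>\<omega>. W t \<omega> - W s \<omega>) (normal_density 0 \<sigma>)"
    using W st False by (auto simp: wiener_process_def \<sigma>_def)
  then have "distributed M lborel (\<lambda>\<omega>. (W t \<omega> - W s \<omega>) / \<sigma>) std_normal_density"
    using normal_standard_normal_convert[OF \<sigma>(1)] by simp
  then have "distr M lborel (\<lambda>\<omega>. (W t \<omega> - W s \<omega>) / \<sigma>) = std_normal_distribution"
    by (simp add: distributed_def)
  moreover have "distr M lborel (\<lambda>\<omega>. (W t \<omega> - W s \<omega>) / \<sigma>) = distr M borel (\<lambda>\<omega>. (W t \<omega> - W s \<omega>) / \<sigma>)"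
    by (rule distr_cong) auto
  ultimately have "char (distr M borel (\<lambda>\<omega>. (W t \<omega> - W s \<omega>) / \<sigma>)) (r * c * \<sigma>)
      = of_real (exp (- ((r * c * \<sigma>)\<^sup>2) / 2))"
    by (simp only: char_std_normal_distribution)
  moreover have "char (distr M borel (\<lambda>\<omega>. (W t \<omega> - W s \<omega>) / \<sigma>)) (r * c * \<sigma>)
      = char (distr M borel (\<lambda>\<omega>. c * (W t \<omega> - W s \<omega>))) r"
    using \<sigma>(1) by (simp add: char_distr mult.assoc)
  ultimately show ?thesis using \<sigma>(2) by (simp add: power_mult_distrib mult.assoc)
qed

text \<open>Independence of the increments turns the characteristic function into a product of
  Gaussian ones, whose exponents add up: a discrete form of the Ito isometry.\<close>

lemma wiener_riemann_sum_char:
  assumes W: "wiener_process M W" and "0 \<le> t"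
  shows "char (distr M borel (\<lambda>\<omega>. riemann_sum f (\<lambda>s. W s \<omega>) t n)) r
           = of_real (exp (- (r\<^sup>2 * riemann_sum (\<lambda>s. (f s)\<^sup>2) (\<lambda>s. s) t n) / 2))"
\<comment> \<open>In these two cases the grid is not strictly increasing, so independence of
  increments cannot be invoked, but the sum is identically \<open>0\<close>.\<close>
proof (cases "t = 0 \<or> n = 0")
  case True
  interpret prob_space M using W by (simp add: wiener_process_def)
  show ?thesis using True by (auto simp: riemann_sum_def char_def integral_return)
next
  case False
  then have tn: "t > 0" "n > 0" using \<open>0 \<le> t\<close> by auto
  interpret prob_space M using W by (simp add: wiener_process_def)
  define \<tau> where "\<tau> i = t * real i / real n" for i
  have tau: "0 \<le> \<tau> 0" "0 \<le> \<tau> i" "\<tau> i < \<tau> (Suc i)" for i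
    using tn by (auto simp: \<tau>_def divide_strict_right_mono)
  have "indep_vars (\<lambda>_. borel) (\<lambda>i \<omega>. W (\<tau> (Suc i)) \<omega> - W (\<tau> i) \<omega>) {..<n}"
    using W tau unfolding wiener_process_def by blast
  then have "indep_vars (\<lambda>_. borel) (\<lambda>i \<omega>. f (\<tau> i) * (W (\<tau> (Suc i)) \<omega> - W (\<tau> i) \<omega>)) {..<n}"
    by (rule indep_vars_compose2) auto
  then have "char (distr M borel (\<lambda>\<omega>. \<Sum>i<n. f (\<tau> i) * (W (\<tau> (Suc i)) \<omega> - W (\<tau> i) \<omega>))) r
      = (\<Prod>i<n. of_real (exp (- (r\<^sup>2 * ((f (\<tau> i))\<^sup>2 * (\<tau> (Suc i) - \<tau> i))) / 2)))"
    using tau by (subst char_distr_sum) (auto simp: wiener_increment_char[OF W] less_imp_le)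
  also have "\<dots> = of_real (exp (\<Sum>i<n. - (r\<^sup>2 * ((f (\<tau> i))\<^sup>2 * (\<tau> (Suc i) - \<tau> i))) / 2))"
    by (simp add: exp_sum)
  also have "(\<Sum>i<n. - (r\<^sup>2 * ((f (\<tau> i))\<^sup>2 * (\<tau> (Suc i) - \<tau> i))) / 2)
      = - (r\<^sup>2 * riemann_sum (\<lambda>s. (f s)\<^sup>2) (\<lambda>s. s) t n) / 2"
    by (simp add: riemann_sum_def \<tau>_def sum_distrib_left sum_divide_distrib sum_negf)
  finally show ?thesis by (simp add: riemann_sum_def \<tau>_def)
qed

text \<open>Unlike \<^const>\<open>gaussian\<close>, this is the Dirac mass at \<open>m\<close> for \<open>s = 0\<close>, as needed at time \<open>0\<close>.\<close>

definition affine_normal :: "real \<Rightarrow> real \<Rightarrow> real measure" where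
  "affine_normal m s = distr std_normal_distribution borel (\<lambda>z. m + s * z)"

text \<open>Dominated convergence with bound \<open>1\<close> carries almost sure convergence over
  to the characteristic functions. The limit is that of a centred Gaussian with variance
  \<open>s * s\<close>, the shift by \<open>m\<close> is a phase factor, and Levy uniqueness
  concludes, also for \<open>s = 0\<close>.\<close>

lemma distr_eq_affine_normal:
  assumes M: "prob_space M" and X: "X \<in> borel_measurable M"
    and F: "\<And>n. F n \<in> borel_measurable M"
    and lim: "AE \<omega> in M. (\<lambda>n. F n \<omega>) \<longlonglongrightarrow> X \<omega> - m"
    and char: "\<And>n r. char (distr M borel (F n)) r = of_real (exp (- (r\<^sup>2 * V n) / 2))"
    and V: "V \<longlonglongrightarrow> s\<^sup>2"
  shows "distr M borel X = affine_normal m s"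
proof -
  interpret prob_space M by fact
  note [measurable] = X F
  have "char (distr M borel X) r = char (affine_normal m s) r" for r
  proof -
    have "(\<lambda>n. CLINT \<omega>|M. iexp (r * F n \<omega>)) \<longlonglongrightarrow> (CLINT \<omega>|M. iexp (r * (X \<omega> - m)))"
    proof (rule integral_dominated_convergence[where w = "\<lambda>_. 1"])
      show "AE \<omega> in M. (\<lambda>n. iexp (r * F n \<omega>)) \<longlonglongrightarrow> iexp (r * (X \<omega> - m))"
        using lim by eventually_elim (intro tendsto_intros)
    qed auto
    moreover have "(\<lambda>n. CLINT \<omega>|M. iexp (r * F n \<omega>)) = (\<lambda>n. of_real (exp (- (r\<^sup>2 * V n) / 2)))"
      using char F by (simp add: char_distr)
    moreover have "(\<lambda>n. complex_of_real (exp (- (r\<^sup>2 * V n) / 2)))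
        \<longlonglongrightarrow> of_real (exp (- (r\<^sup>2 * s\<^sup>2) / 2))"
      by (intro tendsto_intros V) auto
    ultimately have *: "(CLINT \<omega>|M. iexp (r * (X \<omega> - m))) = of_real (exp (- (r\<^sup>2 * s\<^sup>2) / 2))"
      using LIMSEQ_unique by metis
    have "char (distr M borel X) r = (CLINT \<omega>|M. iexp (r * m) * iexp (r * (X \<omega> - m)))"
      by (simp add: char_distr algebra_simps flip: exp_add)
    also have "\<dots> = iexp (r * m) * of_real (exp (- (r\<^sup>2 * s\<^sup>2) / 2))"
      using * by simp
    also have "of_real (exp (- (r\<^sup>2 * s\<^sup>2) / 2)) = char std_normal_distribution (r * s)"
      by (simp add: char_std_normal_distribution power_mult_distrib)
    also have "iexp (r * m) * \<dots> = char (affine_normal m s) r"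
      unfolding affine_normal_def by (subst char_distr) (auto simp: char_def algebra_simps exp_add
          simp flip: integral_mult_right_zero)
    finally show ?thesis .
  qed
  moreover have "real_distribution (distr M borel X)" by (intro real_distribution_distr X)
  moreover have "real_distribution (affine_normal m s)"
    unfolding affine_normal_def
    by (intro prob_space.real_distribution_distr prob_space_normal_density) auto
  ultimately show ?thesis by (intro Levy_uniqueness) auto
qed

lemma gaussian_eq_affine_normal:
  assumes "v > 0"
  shows "gaussian m v = affine_normal m (sqrt v)"
proof -
  interpret prob_space std_normal_distribution by (rule prob_space_normal_density) simp
  have "distributed std_normal_distribution lborel (\<lambda>x. x) std_normal_density"
    by (auto simp: distributed_def distr_id2)
  from normal_density_affine[OF this, of "sqrt v" m] assms
  have "distr std_normal_distribution lborel (\<lambda>x. m + sqrt v * x) = gaussian m v"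
    by (simp add: distributed_def gaussian_def)
  moreover have "distr std_normal_distribution lborel (\<lambda>x. m + sqrt v * x) = affine_normal m (sqrt v)"
    unfolding affine_normal_def by (rule distr_cong) auto
  ultimately show ?thesis by simp
qed

section \<open>Wasserstein bound between affine images of one normal variable\<close>

text \<open>Both marginals are driven by the same \<open>z\<close>. The cost of this coupling is the
  second moment of \<open>m - m' + (s - s') * z\<close>, whose cross term vanishes because
  \<open>z\<close> is centred.\<close>

lemma transport_cost_affine_normal:
  "transport_cost (affine_normal m s) (affine_normal m' s') \<le> ennreal ((m - m')\<^sup>2 + (s - s')\<^sup>2)"
proof -
  let ?N = std_normal_distribution
  interpret prob_space ?N by (rule prob_space_normal_density) simp
  let ?T = "\<lambda>z. (m + s * z, m' + s' * z)"
  define \<pi> where "\<pi> = distr ?N borel ?T"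
  have T [measurable]: "?T \<in> borel_measurable borel"
    by (intro borel_measurable_Pair) auto
  have "\<pi> \<in> couplings (affine_normal m s) (affine_normal m' s')"
    unfolding couplings_def \<pi>_def affine_normal_def
    by (auto intro!: prob_space_distr simp: distr_distr comp_def borel_prod[symmetric])
  moreover have [measurable]: "(\<lambda>z::real \<times> real. (fst z - snd z)\<^sup>2) \<in> borel_measurable borel"
    by (intro borel_measurable_continuous_onI continuous_intros)
  ultimately have "transport_cost (affine_normal m s) (affine_normal m' s')
      \<le> (\<integral>\<^sup>+ z. ennreal (\<bar>fst z - snd z\<bar>\<^sup>2) \<partial>\<pi>)"
    unfolding transport_cost_def by (intro INF_lower)
  also have "\<dots> = (\<integral>\<^sup>+ z. ennreal ((m - m' + (s - s') * z)\<^sup>2) \<partial>?N)"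
    unfolding \<pi>_def by (subst nn_integral_distr) (auto simp: algebra_simps)
  also have "\<dots> = ennreal ((m - m')\<^sup>2 + (s - s')\<^sup>2)"
  proof -
    have i: "integrable ?N (\<lambda>z. z)" "integrable ?N (\<lambda>z. z\<^sup>2)"
      using integrable_std_normal_distribution_moment[of 1]
        integrable_std_normal_distribution_moment[of 2] by simp_all
    have e: "(LINT z|?N. z) = 0" "(LINT z|?N. z\<^sup>2) = 1"
      using integral_std_normal_distribution_moment_odd[of 1]
        std_normal_distribution_even_moments(1)[of 1] by simp_all
    have eq: "(\<lambda>z. (m - m' + (s - s') * z)\<^sup>2)
        = (\<lambda>z. (m - m')\<^sup>2 + 2 * (m - m') * (s - s') * z + (s - s')\<^sup>2 * z\<^sup>2)"
      by (auto simp: power2_eq_square algebra_simps)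
    have "(LINT z|?N. (m - m' + (s - s') * z)\<^sup>2) = (m - m')\<^sup>2 + (s - s')\<^sup>2"
      unfolding eq using i prob_space by (simp add: e)
    moreover have "integrable ?N (\<lambda>z. (m - m' + (s - s') * z)\<^sup>2)"
      unfolding eq using i by simp
    ultimately show ?thesis by (simp add: nn_integral_eq_integral)
  qed
  finally show ?thesis .
qed

text \<open>The real bound on the cost excludes the infinite branch of \<open>W2_dist\<close>, after
  which the square root can be taken in the reals.\<close>

lemma W2_dist_affine_normal:
  assumes "(m - m')\<^sup>2 + (s - s')\<^sup>2 \<le> L\<^sup>2" "0 \<le> L"
  shows "W2_dist (affine_normal m s) (affine_normal m' s') \<le> ennreal L"
proof -
  let ?c = "transport_cost (affine_normal m s) (affine_normal m' s')"
  have c: "?c \<le> ennreal (L\<^sup>2)"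
    using transport_cost_affine_normal assms(1) by (rule order_trans[OF _ ennreal_leI])
  then have "?c \<noteq> \<infinity>" by (auto simp: top_unique)
  moreover have "enn2real ?c \<le> L\<^sup>2"
    using c by (simp add: enn2real_leI)
  then have "sqrt (enn2real ?c) \<le> L"
    using assms(2) by (simp add: real_le_lsqrt)
  ultimately show ?thesis by (simp add: W2_dist_def ennreal_leI)
qed


section \<open>Laws of the reduced and of the coupled dynamics\<close>

lemma riemann_sum_measurable:
  assumes "wiener_process M W" "0 \<le> t"
  shows "(\<lambda>\<omega>. riemann_sum f (\<lambda>s. W s \<omega>) t n) \<in> borel_measurable M"
proof -
  have "W s \<in> borel_measurable M" if "0 \<le> s" for s
    using assms that by (simp add: wiener_process_def)
  then show ?thesis using assms(2) unfolding riemann_sum_def by (intro borel_measurable_sum) simp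
qed

text \<open>A Riemann sum reads the path at finitely many nonnegative times, so it is a measurable
  function on the product space in which independence of processes is formulated.\<close>

lemma indep_riemann_sums:
  assumes M: "prob_space M" and indep: "indep_processes M W1 W2" and "0 \<le> t"
  shows "prob_space.indep_var M borel (\<lambda>\<omega>. riemann_sum f (\<lambda>s. W1 s \<omega>) t n)
           borel (\<lambda>\<omega>. riemann_sum g (\<lambda>s. W2 s \<omega>) t n)"
proof -
  interpret prob_space M by fact
  have meas: "(\<lambda>p. riemann_sum h p t n) \<in> borel_measurable (PiM {0..} (\<lambda>_. borel))" for h
    unfolding riemann_sum_def
    by (intro borel_measurable_sum borel_measurable_times borel_measurable_diff
        borel_measurable_const measurable_component_singleton) (use \<open>0 \<le> t\<close> in auto)
  have eq: "(\<lambda>p. riemann_sum h p t n) \<circ> (\<lambda>\<omega>. \<lambda>s\<in>{0..}. W s \<omega>) = (\<lambda>\<omega>. riemann_sum h (\<lambda>s. W s \<omega>) t n)"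
    for h and W :: "real \<Rightarrow> 'a \<Rightarrow> real"
    using \<open>0 \<le> t\<close> by (auto simp: riemann_sum_def fun_eq_iff)
  show ?thesis
    using indep_var_compose[OF indep[unfolded indep_processes_def] meas[of f] meas[of g]]
    by (simp only: eq)
qed

lemma reduced_dynamics_law:
  assumes R: "reduced_dynamics a k x0 M W X" and D: "0 \<le> D_hat a k" and "a < 0" "0 \<le> t"
  shows "distr M borel (X t)
           = affine_normal (exp (a * t) * x0) (sqrt (Sigma11_bar a k * (1 - exp (2 * a * t))))"
proof -
  have W: "wiener_process M W" and M: "prob_space M" and X: "X t \<in> borel_measurable M"
    using R \<open>0 \<le> t\<close> by (auto simp: reduced_dynamics_def wiener_process_def)
  define c where "c = noise_amplitude (D_hat a k)"
  have c: "c\<^sup>2 = 2 * D_hat a k" using D by (simp add: c_def noise_amplitude_def)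
  define f where "f s = c * exp (a * (t - s))" for s
  have sol: "AE \<omega> in M. \<forall>t\<ge>0.
      ((\<lambda>s. lambda_plus a * X s \<omega>) has_integral (X t \<omega> - x0 - c * W t \<omega>)) {0..t}"
    using R by (simp add: reduced_dynamics_def c_def)
  have cont: "AE \<omega> in M. continuous_on {0..} (\<lambda>t. W t \<omega>)" and zero: "AE \<omega> in M. W 0 \<omega> = 0"
    using W by (auto simp: wiener_process_def)
  have lim: "AE \<omega> in M. (\<lambda>n. riemann_sum f (\<lambda>s. W s \<omega>) t n) \<longlonglongrightarrow> X t \<omega> - exp (a * t) * x0"
    using sol cont zero
  proof eventually_elim
    fix \<omega>
    assume \<omega>: "\<forall>t\<ge>0. ((\<lambda>s. lambda_plus a * X s \<omega>) has_integral (X t \<omega> - x0 - c * W t \<omega>)) {0..t}"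
      "continuous_on {0..} (\<lambda>t. W t \<omega>)" "W 0 \<omega> = 0"
    have "riemann_sum (\<lambda>s. exp (a * (t - s))) (\<lambda>s. c * W s \<omega>) t \<longlonglongrightarrow> X t \<omega> - exp (a * t) * x0"
      using \<omega> \<open>0 \<le> t\<close>
      by (intro linear_ode_riemann_sum)
         (auto simp: lambda_plus_def intro!: continuous_intros intro: continuous_on_subset)
    moreover have "riemann_sum (\<lambda>s. exp (a * (t - s))) (\<lambda>s. c * W s \<omega>) t
        = riemann_sum f (\<lambda>s. W s \<omega>) t"
      by (simp add: riemann_sum_def f_def algebra_simps fun_eq_iff)
    ultimately show "(\<lambda>n. riemann_sum f (\<lambda>s. W s \<omega>) t n) \<longlonglongrightarrow> X t \<omega> - exp (a * t) * x0"
      by simp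
  qed
  have "Sigma11_bar a k \<ge> 0"
    using D \<open>a < 0\<close> by (simp add: D_hat_def lambda_plus_def mult_le_0_iff zero_le_mult_iff)
  moreover have "exp (2 * a * t) \<le> 1" using assms by (simp add: mult_nonpos_nonneg)
  ultimately have "(sqrt (Sigma11_bar a k * (1 - exp (2 * a * t))))\<^sup>2
      = Sigma11_bar a k * (1 - exp (2 * a * t))"
    by (intro real_sqrt_pow2 mult_nonneg_nonneg) auto
  \<comment> \<open>Here the choice \<open>D_hat = - a * Sigma11_bar\<close> enters: it calibrates
    the noise so that the stationary variance is exactly \<open>Sigma11_bar\<close>.\<close>
  also have "\<dots> = c\<^sup>2 * ((exp (2 * a * t) - 1) / (2 * a))"
    using \<open>a < 0\<close> by (simp add: c D_hat_def lambda_plus_def field_simps)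
  finally have var: "(sqrt (Sigma11_bar a k * (1 - exp (2 * a * t))))\<^sup>2
      = c\<^sup>2 * ((exp (2 * a * t) - 1) / (2 * a))" .
  have "(\<lambda>n. c\<^sup>2 * riemann_sum (\<lambda>s. exp (2 * a * (t - s))) (\<lambda>s. s) t n)
      \<longlonglongrightarrow> c\<^sup>2 * ((exp (2 * a * t) - 1) / (2 * a))"
    using assms by (intro tendsto_intros riemann_sum_exp) auto
  moreover have "(f s)\<^sup>2 = c\<^sup>2 * exp (2 * a * (t - s))" for s
    by (simp add: f_def power_mult_distrib mult.assoc flip: exp_double)
  then have "riemann_sum (\<lambda>s. (f s)\<^sup>2) (\<lambda>s. s) t
      = (\<lambda>n. c\<^sup>2 * riemann_sum (\<lambda>s. exp (2 * a * (t - s))) (\<lambda>s. s) t n)"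
    by (intro ext) (simp only: riemann_sum_def sum_distrib_left mult.assoc)
  ultimately have "riemann_sum (\<lambda>s. (f s)\<^sup>2) (\<lambda>s. s) t
      \<longlonglongrightarrow> (sqrt (Sigma11_bar a k * (1 - exp (2 * a * t))))\<^sup>2"
    unfolding var by simp
  then show ?thesis
    by (rule distr_eq_affine_normal[OF M X riemann_sum_measurable[OF W \<open>0 \<le> t\<close>] lim
          wiener_riemann_sum_char[OF W \<open>0 \<le> t\<close>]])
qed

text \<open>First component of the matrix exponential of the drift applied to the initial datum;
  \<open>a\<close> and \<open>b\<close> are the rates of the symmetric and the antisymmetric
  mode.\<close>

definition coupled_mean :: "real \<Rightarrow> real \<Rightarrow> real \<Rightarrow> real \<Rightarrow> real \<Rightarrow> real" where
  "coupled_mean a b x10 x20 t = (exp (a * t) * (x10 + x20) + exp (b * t) * (x10 - x20)) / 2"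

text \<open>The integral of \<open>exp (2 * a * (t - s)) + exp (2 * b * (t - s))\<close> over
  \<open>s\<close> from \<open>0\<close> to \<open>t\<close>.\<close>

definition coupled_variance :: "real \<Rightarrow> real \<Rightarrow> real \<Rightarrow> real" where
  "coupled_variance a b t = (exp (2 * a * t) - 1) / (2 * a) + (exp (2 * b * t) - 1) / (2 * b)"

lemma coupled_variance_nonneg:
  assumes "a < 0" "b < 0" "0 \<le> t"
  shows "0 \<le> coupled_variance a b t"
  unfolding coupled_variance_def using assms
  by (intro add_nonneg_nonneg divide_nonpos_neg) (auto simp: mult_nonpos_nonneg)

text \<open>Half the sum of the two decoupled modes recovers \<open>X1\<close>. Its Riemann sum is
  regrouped by the independent sources \<open>W1\<close> and \<open>W2\<close>, because the two
  modes share both noises.\<close>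

lemma coupled_dynamics_law:
  assumes C: "coupled_dynamics a k x10 x20 M W1 W2 X1 X2" and "a < 0" "0 < k" "0 \<le> t"
  defines "b \<equiv> a - 2 * k"
  shows "distr M borel (X1 t)
           = affine_normal (coupled_mean a b x10 x20 t) (sqrt (coupled_variance a b t))"
proof -
  have W: "wiener_process M W1" "wiener_process M W2" and ind: "indep_processes M W1 W2"
    and M: "prob_space M" and X: "X1 t \<in> borel_measurable M"
    using C \<open>0 \<le> t\<close> by (auto simp: coupled_dynamics_def wiener_process_def)
  interpret prob_space M by fact
  have b: "b < 0" using assms by (simp add: b_def)
  define c where "c = noise_amplitude 1"
  have c: "c\<^sup>2 = 2" by (simp add: c_def noise_amplitude_def)
  define E where "E r s = exp (r * (t - s))" for r s
  \<comment> \<open>\<open>W1\<close> enters both modes with the same sign and \<open>W2\<close>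
    with opposite signs; hence half the sum and half the difference of the mode kernels.\<close>
  define f where "f s = c * (E a s + E b s) / 2" for s
  define g where "g s = c * (E a s - E b s) / 2" for s
  define F where "F n \<omega> = riemann_sum f (\<lambda>s. W1 s \<omega>) t n + riemann_sum g (\<lambda>s. W2 s \<omega>) t n" for n \<omega>
  define V where "V n = riemann_sum (\<lambda>s. (f s)\<^sup>2) (\<lambda>s. s) t n + riemann_sum (\<lambda>s. (g s)\<^sup>2) (\<lambda>s. s) t n" for n
  have sol: "AE \<omega> in M. \<forall>t\<ge>0.
        ((\<lambda>s. a * X1 s \<omega> + k * (X2 s \<omega> - X1 s \<omega>)) has_integral (X1 t \<omega> - x10 - c * W1 t \<omega>)) {0..t} \<and>
        ((\<lambda>s. - k * (X2 s \<omega> - X1 s \<omega>) + a * X2 s \<omega>) has_integral (X2 t \<omega> - x20 - c * W2 t \<omega>)) {0..t}"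
    using C by (simp add: coupled_dynamics_def c_def)
  have cont: "AE \<omega> in M. continuous_on {0..} (\<lambda>t. W1 t \<omega>)" "AE \<omega> in M. continuous_on {0..} (\<lambda>t. W2 t \<omega>)"
    and zero: "AE \<omega> in M. W1 0 \<omega> = 0" "AE \<omega> in M. W2 0 \<omega> = 0"
    using W by (auto simp: wiener_process_def)
  have lim: "AE \<omega> in M. (\<lambda>n. F n \<omega>) \<longlonglongrightarrow> X1 t \<omega> - coupled_mean a b x10 x20 t"
    using sol cont zero
  proof eventually_elim
    fix \<omega>
    assume sol: "\<forall>t\<ge>0.
        ((\<lambda>s. a * X1 s \<omega> + k * (X2 s \<omega> - X1 s \<omega>)) has_integral (X1 t \<omega> - x10 - c * W1 t \<omega>)) {0..t} \<and>
        ((\<lambda>s. - k * (X2 s \<omega> - X1 s \<omega>) + a * X2 s \<omega>) has_integral (X2 t \<omega> - x20 - c * W2 t \<omega>)) {0..t}"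
      and W\<omega>: "continuous_on {0..} (\<lambda>t. W1 t \<omega>)" "continuous_on {0..} (\<lambda>t. W2 t \<omega>)"
        "W1 0 \<omega> = 0" "W2 0 \<omega> = 0"
    let ?u = "\<lambda>s. c * (W1 s \<omega> + W2 s \<omega>)" and ?v = "\<lambda>s. c * (W1 s \<omega> - W2 s \<omega>)"
    have u: "riemann_sum (E a) ?u t \<longlonglongrightarrow> (X1 t \<omega> + X2 t \<omega>) - exp (a * t) * (x10 + x20)"
      unfolding E_def[abs_def]
    proof (rule linear_ode_riemann_sum)
      fix s assume "s \<in> {0..t}"
      then show "((\<lambda>r. a * (X1 r \<omega> + X2 r \<omega>)) has_integral
          (X1 s \<omega> + X2 s \<omega>) - (x10 + x20) - c * (W1 s \<omega> + W2 s \<omega>)) {0..s}"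
        using has_integral_add[OF sol[rule_format, of s, THEN conjunct1] sol[rule_format, of s, THEN conjunct2]]
        by (simp add: algebra_simps)
    qed (use W\<omega> in \<open>auto intro!: continuous_intros intro: continuous_on_subset \<open>0 \<le> t\<close>\<close>)
    have v: "riemann_sum (E b) ?v t \<longlonglongrightarrow> (X1 t \<omega> - X2 t \<omega>) - exp (b * t) * (x10 - x20)"
      unfolding E_def[abs_def]
    proof (rule linear_ode_riemann_sum)
      fix s assume "s \<in> {0..t}"
      then show "((\<lambda>r. b * (X1 r \<omega> - X2 r \<omega>)) has_integral
          (X1 s \<omega> - X2 s \<omega>) - (x10 - x20) - c * (W1 s \<omega> - W2 s \<omega>)) {0..s}"
        using has_integral_diff[OF sol[rule_format, of s, THEN conjunct1] sol[rule_format, of s, THEN conjunct2]]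
        by (simp add: b_def algebra_simps)
    qed (use W\<omega> in \<open>auto intro!: continuous_intros intro: continuous_on_subset \<open>0 \<le> t\<close>\<close>)
    have F: "F n \<omega> = (riemann_sum (E a) ?u t n + riemann_sum (E b) ?v t n) / 2" for n
      unfolding F_def riemann_sum_def sum.distrib[symmetric] sum_divide_distrib
      by (intro sum.cong refl) (simp add: f_def g_def field_simps)
    have "(\<lambda>n. (riemann_sum (E a) ?u t n + riemann_sum (E b) ?v t n) / 2)
        \<longlonglongrightarrow> ((X1 t \<omega> + X2 t \<omega> - exp (a * t) * (x10 + x20))
             + (X1 t \<omega> - X2 t \<omega> - exp (b * t) * (x10 - x20))) / 2"
      by (intro tendsto_intros u v) auto
    also have "((X1 t \<omega> + X2 t \<omega> - exp (a * t) * (x10 + x20))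
             + (X1 t \<omega> - X2 t \<omega> - exp (b * t) * (x10 - x20))) / 2
        = X1 t \<omega> - coupled_mean a b x10 x20 t"
      by (simp add: coupled_mean_def field_simps)
    finally show "(\<lambda>n. F n \<omega>) \<longlonglongrightarrow> X1 t \<omega> - coupled_mean a b x10 x20 t"
      unfolding F .
  qed
  have char: "char (distr M borel (F n)) r = of_real (exp (- (r\<^sup>2 * V n) / 2))" for n r
  proof -
    have exps: "exp (- (r\<^sup>2 * p) / 2) * exp (- (r\<^sup>2 * q) / 2) = exp (- (r\<^sup>2 * (p + q)) / 2)"
      for p q :: real
      by (simp add: field_simps flip: exp_add)
    show ?thesis
      unfolding F_def[abs_def] V_def
        char_distr_add[OF indep_riemann_sums[OF M ind \<open>0 \<le> t\<close>]]
        wiener_riemann_sum_char[OF W(1) \<open>0 \<le> t\<close>] wiener_riemann_sum_char[OF W(2) \<open>0 \<le> t\<close>]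
        of_real_mult[symmetric] exps ..
  qed
  \<comment> \<open>The mixed terms of the two squares cancel, and \<open>c * c = 2\<close> absorbs
    the remaining factor one half, so the variance splits into one sum per mode.\<close>
  have "V = (\<lambda>n. riemann_sum (E (2 * a)) (\<lambda>s. s) t n + riemann_sum (E (2 * b)) (\<lambda>s. s) t n)"
  proof -
    have "(f s)\<^sup>2 + (g s)\<^sup>2 = E (2 * a) s + E (2 * b) s" for s
    proof -
      have "(f s)\<^sup>2 + (g s)\<^sup>2 = c\<^sup>2 * ((E a s)\<^sup>2 + (E b s)\<^sup>2) / 2"
        by (simp add: f_def g_def power2_eq_square field_simps)
      then show ?thesis by (simp add: c E_def mult.assoc flip: exp_double)
    qed
    then show ?thesis
      unfolding V_def riemann_sum_def by (simp add: fun_eq_iff flip: sum.distrib distrib_right)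
  qed
  moreover have "(\<lambda>n. riemann_sum (E (2 * a)) (\<lambda>s. s) t n + riemann_sum (E (2 * b)) (\<lambda>s. s) t n)
      \<longlonglongrightarrow> coupled_variance a b t"
    unfolding coupled_variance_def E_def[abs_def]
    using assms b by (intro tendsto_add riemann_sum_exp) auto
  ultimately have V: "V \<longlonglongrightarrow> (sqrt (coupled_variance a b t))\<^sup>2"
    using coupled_variance_nonneg[OF \<open>a < 0\<close> b \<open>0 \<le> t\<close>] by simp
  show ?thesis
    using riemann_sum_measurable[OF W(1) \<open>0 \<le> t\<close>] riemann_sum_measurable[OF W(2) \<open>0 \<le> t\<close>]
    by (intro distr_eq_affine_normal[OF M X _ lim char V]) (simp add: F_def[abs_def])
qed

section \<open>Explicit estimates for means and variances\<close>

text \<open>One of the two factors \<open>\<bar>sqrt u - sqrt v\<bar>\<close> is enlarged to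
  \<open>sqrt u + sqrt v\<close>, which leaves a difference of squares.\<close>

lemma sqrt_diff_power2_le:
  fixes u v :: real
  assumes "0 \<le> u" "0 \<le> v"
  shows "(sqrt u - sqrt v)\<^sup>2 \<le> \<bar>u - v\<bar>"
proof -
  have "(sqrt u - sqrt v)\<^sup>2 = \<bar>sqrt u - sqrt v\<bar> * \<bar>sqrt u - sqrt v\<bar>"
    by (simp add: power2_eq_square)
  also have "\<dots> \<le> \<bar>sqrt u - sqrt v\<bar> * (sqrt u + sqrt v)"
    using assms by (intro mult_left_mono) (auto simp: abs_le_iff)
  also have "\<dots> = \<bar>(sqrt u - sqrt v) * (sqrt u + sqrt v)\<bar>"
    using assms by (simp add: abs_mult)
  also have "(sqrt u - sqrt v) * (sqrt u + sqrt v) = u - v"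
    using assms by (simp add: algebra_simps)
  finally show ?thesis .
qed

context
  fixes a b k x y t :: real
  assumes a: "a < 0" and k: "0 < k" and t: "0 \<le> t" and b_def: "b = a - 2 * k"
begin

lemma Sigma11_bar_eq: "Sigma11_bar a k = - 1 / (2 * b) - 1 / (2 * a)"
proof -
  have "b < 0" using a k by (simp add: b_def)
  then show ?thesis
    unfolding Sigma11_bar_def b_def[symmetric] using a by (simp add: field_simps)
qed

text \<open>Since \<open>\<bar>a\<bar> \<le> \<bar>b\<bar>\<close>, the upper bound is uniform in
  \<open>k\<close>, as the final constant has to be.\<close>

lemma Sigma11_bar_bounds: "0 < Sigma11_bar a k" "Sigma11_bar a k \<le> 1 / \<bar>a\<bar>"
proof -
  have b: "b < 0" "\<bar>a\<bar> \<le> \<bar>b\<bar>" using a k by (auto simp: b_def)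
  have eq: "Sigma11_bar a k = 1 / (2 * \<bar>b\<bar>) + 1 / (2 * \<bar>a\<bar>)"
    unfolding Sigma11_bar_eq using a b(1) by simp
  have "1 / (2 * \<bar>b\<bar>) \<le> 1 / (2 * \<bar>a\<bar>)" using a b by (intro divide_left_mono mult_pos_pos) auto
  then show "Sigma11_bar a k \<le> 1 / \<bar>a\<bar>" by (simp add: eq)
  show "0 < Sigma11_bar a k" unfolding eq using a b by (intro add_pos_pos) auto
qed

text \<open>With \<open>q = exp (- 2 * k * t)\<close>, mean and variance differ only through the
  antisymmetric mode. The common factor \<open>exp (2 * a * t) * (1 - q * q)\<close> is kept whole:
  it yields both the bound linear in \<open>k\<close> and the exponential decay.\<close>

lemma coupled_reduced_difference:
  "(coupled_mean a b x y t - exp (a * t) * x)\<^sup>2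
     + (sqrt (coupled_variance a b t) - sqrt (Sigma11_bar a k * (1 - exp (2 * a * t))))\<^sup>2
   \<le> ((\<bar>x\<bar> + \<bar>y\<bar>)\<^sup>2 + 1 / \<bar>a\<bar>) * exp (2 * a * t) * (1 - exp (- 4 * k * t))"
proof -
  have b: "b < 0" "\<bar>a\<bar> \<le> \<bar>b\<bar>" using a k by (auto simp: b_def)
  define q where "q = exp (- 2 * k * t)"
  have q: "0 < q" "q \<le> 1" using k t by (auto simp: q_def)
  have qq: "exp (- 4 * k * t) = q\<^sup>2"
    by (simp add: q_def mult.assoc flip: exp_double)
  have eb: "exp (b * t) = exp (a * t) * q" "exp (2 * b * t) = exp (2 * a * t) * q\<^sup>2"
    unfolding qq[symmetric] by (simp_all add: q_def b_def algebra_simps flip: exp_add)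
  have e2: "exp (2 * a * t) = (exp (a * t))\<^sup>2" by (simp add: mult.assoc flip: exp_double)
  have q2: "q\<^sup>2 \<le> q" using q by (simp add: power2_eq_square mult_left_le)
  have "coupled_mean a b x y t - exp (a * t) * x = exp (a * t) * (1 - q) * ((y - x) / 2)"
    by (simp add: coupled_mean_def eb field_simps)
  then have "(coupled_mean a b x y t - exp (a * t) * x)\<^sup>2
      = exp (2 * a * t) * (1 - q)\<^sup>2 * ((y - x) / 2)\<^sup>2"
    by (simp only: power_mult_distrib e2)
  also have "\<dots> \<le> exp (2 * a * t) * (1 - q\<^sup>2) * (\<bar>x\<bar> + \<bar>y\<bar>)\<^sup>2"
  proof (intro mult_mono)
    \<comment> \<open>The gap between the two sides is \<open>2 * (q - q * q)\<close>, nonnegative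
      for \<open>q\<close> in the unit interval.\<close>
    show "(1 - q)\<^sup>2 \<le> 1 - q\<^sup>2" using q2 by (simp add: power2_eq_square algebra_simps)
    show "((y - x) / 2)\<^sup>2 \<le> (\<bar>x\<bar> + \<bar>y\<bar>)\<^sup>2" by (rule abs_le_square_iff[THEN iffD1]) auto
  qed (use q q2 in auto)
  finally have m: "(coupled_mean a b x y t - exp (a * t) * x)\<^sup>2
      \<le> exp (2 * a * t) * (1 - q\<^sup>2) * (\<bar>x\<bar> + \<bar>y\<bar>)\<^sup>2" .
  have "(sqrt (coupled_variance a b t) - sqrt (Sigma11_bar a k * (1 - exp (2 * a * t))))\<^sup>2
      \<le> \<bar>coupled_variance a b t - Sigma11_bar a k * (1 - exp (2 * a * t))\<bar>"
    using a b t by (intro sqrt_diff_power2_le coupled_variance_nonneg mult_nonneg_nonneg)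
      (auto simp: Sigma11_bar_bounds less_imp_le mult_nonpos_nonneg)
  \<comment> \<open>The contributions with denominator \<open>2 * a\<close> cancel, because
    \<open>Sigma11_bar\<close> contains the same term.\<close>
  also have "coupled_variance a b t - Sigma11_bar a k * (1 - exp (2 * a * t))
      = exp (2 * a * t) * (1 - q\<^sup>2) * (- 1 / (2 * b))"
    unfolding coupled_variance_def Sigma11_bar_eq eb using a b by (simp add: field_simps)
  also have "\<bar>\<dots>\<bar> = exp (2 * a * t) * (1 - q\<^sup>2) * (1 / (2 * \<bar>b\<bar>))"
    unfolding abs_mult using q q2 b by simp
  also have "\<dots> \<le> exp (2 * a * t) * (1 - q\<^sup>2) * (1 / \<bar>a\<bar>)"
    using q q2 a b by (intro mult_left_mono frac_le) auto
  finally show ?thesis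
    using m unfolding qq by (simp only: distrib_left distrib_right mult_ac add_mono)
qed

text \<open>As \<open>b < a\<close>, both modes decay at least as fast as
  \<open>exp (a * t)\<close>. The term \<open>- 0\<close> is the mean of the equilibrium, kept so
  that the estimate fits \<open>W2_dist_affine_normal\<close>.\<close>

lemma coupled_equilibrium_difference:
  "(coupled_mean a b x y t - 0)\<^sup>2 + (sqrt (coupled_variance a b t) - sqrt (Sigma11_bar a k))\<^sup>2
   \<le> ((\<bar>x\<bar> + \<bar>y\<bar>)\<^sup>2 + 1 / \<bar>a\<bar>) * exp (2 * a * t)"
proof -
  have b: "b < 0" "\<bar>a\<bar> \<le> \<bar>b\<bar>" using a k by (auto simp: b_def)
  have e2: "exp (2 * a * t) = (exp (a * t))\<^sup>2" by (simp add: mult.assoc flip: exp_double)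
  have le: "exp (b * t) \<le> exp (a * t)" "exp (2 * b * t) \<le> exp (2 * a * t)"
    using k t by (auto simp: b_def mult_right_mono)
  have "\<bar>coupled_mean a b x y t\<bar> \<le> (exp (a * t) * \<bar>x + y\<bar> + exp (b * t) * \<bar>x - y\<bar>) / 2"
    unfolding coupled_mean_def by (simp add: abs_mult abs_triangle_ineq[THEN order_trans])
  also have "\<dots> \<le> (exp (a * t) * (\<bar>x\<bar> + \<bar>y\<bar>) + exp (a * t) * (\<bar>x\<bar> + \<bar>y\<bar>)) / 2"
    using le by (intro divide_right_mono add_mono mult_mono) auto
  finally have "\<bar>coupled_mean a b x y t\<bar> \<le> \<bar>exp (a * t) * (\<bar>x\<bar> + \<bar>y\<bar>)\<bar>" by simp
  then have m: "(coupled_mean a b x y t)\<^sup>2 \<le> exp (2 * a * t) * (\<bar>x\<bar> + \<bar>y\<bar>)\<^sup>2"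
    by (simp only: abs_le_square_iff power_mult_distrib e2)
  have "(sqrt (coupled_variance a b t) - sqrt (Sigma11_bar a k))\<^sup>2
      \<le> \<bar>coupled_variance a b t - Sigma11_bar a k\<bar>"
    using a b t by (intro sqrt_diff_power2_le coupled_variance_nonneg)
      (auto simp: Sigma11_bar_bounds less_imp_le)
  also have "coupled_variance a b t - Sigma11_bar a k
      = - (exp (2 * a * t) * (1 / (2 * \<bar>a\<bar>)) + exp (2 * b * t) * (1 / (2 * \<bar>b\<bar>)))"
    using a b by (simp add: coupled_variance_def Sigma11_bar_eq field_simps)
  also have "\<bar>\<dots>\<bar> = exp (2 * a * t) * (1 / (2 * \<bar>a\<bar>)) + exp (2 * b * t) * (1 / (2 * \<bar>b\<bar>))"
    unfolding abs_minus_cancel by (intro abs_of_nonneg add_nonneg_nonneg) auto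
  also have "\<dots> \<le> exp (2 * a * t) * (1 / (2 * \<bar>a\<bar>)) + exp (2 * a * t) * (1 / (2 * \<bar>a\<bar>))"
    using le a b by (intro add_mono mult_mono divide_left_mono mult_pos_pos order_refl) auto
  finally show ?thesis using m by (simp add: algebra_simps)
qed

text \<open>The variance defect is \<open>exp (2 * a * t) * Sigma11_bar a k\<close>. The datum
  \<open>y\<close> appears in the bound so that all three estimates share one constant.\<close>

lemma reduced_equilibrium_difference:
  "(exp (a * t) * x - 0)\<^sup>2
     + (sqrt (Sigma11_bar a k * (1 - exp (2 * a * t))) - sqrt (Sigma11_bar a k))\<^sup>2
   \<le> ((\<bar>x\<bar> + \<bar>y\<bar>)\<^sup>2 + 1 / \<bar>a\<bar>) * exp (2 * a * t)"
proof -
  have e2: "exp (2 * a * t) = (exp (a * t))\<^sup>2" by (simp add: mult.assoc flip: exp_double)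
  have m: "(exp (a * t) * x)\<^sup>2 \<le> exp (2 * a * t) * (\<bar>x\<bar> + \<bar>y\<bar>)\<^sup>2"
    unfolding power_mult_distrib e2 by (intro mult_left_mono abs_le_square_iff[THEN iffD1]) auto
  have "(sqrt (Sigma11_bar a k * (1 - exp (2 * a * t))) - sqrt (Sigma11_bar a k))\<^sup>2
      \<le> \<bar>Sigma11_bar a k * (1 - exp (2 * a * t)) - Sigma11_bar a k\<bar>"
    using a t Sigma11_bar_bounds by (intro sqrt_diff_power2_le mult_nonneg_nonneg)
      (auto simp: mult_nonpos_nonneg less_imp_le)
  also have "\<dots> = exp (2 * a * t) * Sigma11_bar a k"
    using Sigma11_bar_bounds by (simp add: algebra_simps)
  also have "\<dots> \<le> exp (2 * a * t) * (1 / \<bar>a\<bar>)"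
    using Sigma11_bar_bounds by (intro mult_left_mono) auto
  finally show ?thesis using m by (simp add: algebra_simps)
qed

text \<open>The bound \<open>1 - exp (- 4 * k * t) \<le> 4 * k * t\<close> gives the factor
  \<open>k\<close> but grows in time; the growth is absorbed by the decay, using
  \<open>s \<le> exp s\<close> at \<open>s = 2 * \<bar>a\<bar> * t\<close>.\<close>

lemma exp_decay_times_relaxation_le:
  "exp (2 * a * t) * (1 - exp (- 4 * k * t)) \<le> 2 * k / \<bar>a\<bar>"
proof -
  have "1 - exp (- 4 * k * t) \<le> 4 * k * t"
    using exp_ge_add_one_self[of "- 4 * k * t"] by simp
  then have "exp (2 * a * t) * (1 - exp (- 4 * k * t)) \<le> exp (2 * a * t) * (4 * k * t)"
    by (intro mult_left_mono) auto
  also have "\<dots> = 2 * k / \<bar>a\<bar> * (exp (2 * a * t) * (2 * \<bar>a\<bar> * t))"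
    using a by (simp add: field_simps)
  finally have *: "exp (2 * a * t) * (1 - exp (- 4 * k * t))
      \<le> 2 * k / \<bar>a\<bar> * (exp (2 * a * t) * (2 * \<bar>a\<bar> * t))" .
  have "2 * \<bar>a\<bar> * t \<le> exp (2 * \<bar>a\<bar> * t)"
    by (rule order_trans[OF _ exp_ge_add_one_self]) simp
  then have "2 * k / \<bar>a\<bar> * (exp (2 * a * t) * (2 * \<bar>a\<bar> * t))
      \<le> 2 * k / \<bar>a\<bar> * (exp (2 * a * t) * exp (2 * \<bar>a\<bar> * t))"
    using k by (intro mult_left_mono) auto
  also have "\<dots> = 2 * k / \<bar>a\<bar>" using a by (simp flip: exp_add)
  finally show ?thesis using * by linarith
qed

end

section \<open>A constant uniform in the coupling parameter\<close>

theorem theorem4p1: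
  fixes a x10 x20 :: real
  assumes "a < 0"
  shows "\<exists>C>0. \<forall>k>0.
    \<forall>(M :: 'a measure) W1 W2 X1 X2 (N :: 'b measure) W Xhat.
      coupled_dynamics a k x10 x20 M W1 W2 X1 X2 \<longrightarrow>
      reduced_dynamics a k x10 N W Xhat \<longrightarrow>
      (\<forall>t\<ge>0.
        let \<rho>1 = distr M borel (X1 t);
            \<rho>1hat = distr N borel (Xhat t);
            \<rho>inf = gaussian 0 (Sigma11_bar a k)
        in (W2_dist \<rho>1 \<rho>1hat)\<^sup>2 \<le> ennreal (C * k) \<and>
           max (W2_dist \<rho>1 \<rho>inf) (W2_dist \<rho>1hat \<rho>inf) \<le> ennreal (C * exp (a * t)) \<and>
           W2_dist \<rho>1 \<rho>1hat \<le> ennreal (C * exp (a * t)))"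
proof -
  define L where "L = (\<bar>x10\<bar> + \<bar>x20\<bar>)\<^sup>2 + 1 / \<bar>a\<bar>"
  have L: "L > 0" unfolding L_def using assms by (intro add_nonneg_pos) auto
  \<comment> \<open>The summand \<open>sqrt L\<close> serves the two exponential bounds through
    \<open>L \<le> C * C\<close>, and \<open>2 * L / \<bar>a\<bar>\<close> serves the bound linear
    in \<open>k\<close>. Neither depends on \<open>k\<close>.\<close>
  define C where "C = sqrt L + 2 * L / \<bar>a\<bar>"
  have "2 * L / \<bar>a\<bar> > 0" using L assms by (intro divide_pos_pos) auto
  moreover have "sqrt L > 0" using L by simp
  ultimately have C: "C > 0" "sqrt L \<le> C" "2 * L / \<bar>a\<bar> \<le> C"
    unfolding C_def by linarith+
  have "L = (sqrt L)\<^sup>2" using L by simp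
  also have "\<dots> \<le> C\<^sup>2" using C L by (intro power_mono) auto
  finally have LC: "L \<le> C\<^sup>2" .
  show ?thesis
  proof (rule exI[of _ C], intro conjI allI impI C(1))
    fix k :: real and M :: "'a measure" and W1 W2 X1 X2 and N :: "'b measure" and W Xhat and t :: real
    assume k: "0 < k" and cd: "coupled_dynamics a k x10 x20 M W1 W2 X1 X2"
      and rd: "reduced_dynamics a k x10 N W Xhat" and t: "0 \<le> t"
    define b where "b = a - 2 * k"
    have S: "Sigma11_bar a k > 0"
      using Sigma11_bar_bounds(1)[OF assms k t b_def] .
    then have "D_hat a k \<ge> 0"
      using assms by (simp add: D_hat_def lambda_plus_def mult_nonpos_nonneg)
    note laws = coupled_dynamics_law[OF cd assms k t, folded b_def]
      reduced_dynamics_law[OF rd this assms t] gaussian_eq_affine_normal[OF S]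
    have e2: "L * exp (2 * a * t) \<le> (C * exp (a * t))\<^sup>2"
      using LC by (simp add: power_mult_distrib mult.assoc flip: exp_double)
    have "L * (exp (2 * a * t) * (1 - exp (- 4 * k * t))) \<le> L * (2 * k / \<bar>a\<bar>)"
      using exp_decay_times_relaxation_le[OF assms k t b_def] L by (intro mult_left_mono) auto
    also have "\<dots> = 2 * L / \<bar>a\<bar> * k" by simp
    also have "\<dots> \<le> C * k" using C k by (intro mult_right_mono) auto
    also have "\<dots> = (sqrt (C * k))\<^sup>2" using C k by simp
    finally have 1: "L * exp (2 * a * t) * (1 - exp (- 4 * k * t)) \<le> (sqrt (C * k))\<^sup>2"
      by (simp add: mult.assoc)
    \<comment> \<open>For the decay estimate the relaxation factor is simply bounded by
      \<open>1\<close>.\<close>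
    have "L * exp (2 * a * t) * (1 - exp (- 4 * k * t)) \<le> L * exp (2 * a * t)"
      using L by (simp add: mult_left_le)
    then have 3: "L * exp (2 * a * t) * (1 - exp (- 4 * k * t)) \<le> (C * exp (a * t))\<^sup>2"
      using e2 by linarith
    note diffs = coupled_reduced_difference[OF assms k t b_def, of x10 x20, folded L_def]
      coupled_equilibrium_difference[OF assms k t b_def, of x10 x20, folded L_def]
      reduced_equilibrium_difference[OF assms k t b_def, of x10 x20, folded L_def]
    have "W2_dist (distr M borel (X1 t)) (distr N borel (Xhat t)) \<le> ennreal (sqrt (C * k))"
      unfolding laws using diffs(1) 1 C k by (intro W2_dist_affine_normal) auto
    then have "(W2_dist (distr M borel (X1 t)) (distr N borel (Xhat t)))\<^sup>2 \<le> (ennreal (sqrt (C * k)))\<^sup>2"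
      by (rule power_mono) simp
    also have "\<dots> = ennreal (C * k)" using C k by (simp add: ennreal_power)
    finally have i: "(W2_dist (distr M borel (X1 t)) (distr N borel (Xhat t)))\<^sup>2 \<le> ennreal (C * k)" .
    have iii: "W2_dist (distr M borel (X1 t)) (distr N borel (Xhat t)) \<le> ennreal (C * exp (a * t))"
      unfolding laws using diffs(1) 3 C by (intro W2_dist_affine_normal) auto
    have "W2_dist (distr M borel (X1 t)) (gaussian 0 (Sigma11_bar a k)) \<le> ennreal (C * exp (a * t))"
      unfolding laws using diffs(2) e2 C by (intro W2_dist_affine_normal) auto
    moreover have "W2_dist (distr N borel (Xhat t)) (gaussian 0 (Sigma11_bar a k)) \<le> ennreal (C * exp (a * t))"
      unfolding laws using diffs(3) e2 C by (intro W2_dist_affine_normal) auto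
    ultimately show "let \<rho>1 = distr M borel (X1 t);
            \<rho>1hat = distr N borel (Xhat t);
            \<rho>inf = gaussian 0 (Sigma11_bar a k)
        in (W2_dist \<rho>1 \<rho>1hat)\<^sup>2 \<le> ennreal (C * k) \<and>
           max (W2_dist \<rho>1 \<rho>inf) (W2_dist \<rho>1hat \<rho>inf) \<le> ennreal (C * exp (a * t)) \<and>
           W2_dist \<rho>1 \<rho>1hat \<le> ennreal (C * exp (a * t))"
      using i iii by (simp add: Let_def)
  qed
qed

end
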